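(* Let $L$ be any logic such that $\mathbf{IL}^-\subseteq L\subseteq\mathbf{CL}$. Then $L$ has neither $\ell$FPP nor the Craig interpolation property (CIP).
   Context: Formulas are generated by $A ::= \bot \mid p \mid A \to A \mid \Box A \mid A \rhd A$, where $p$ ranges over a countably infinite set of propositional variables. The symbols $\neg,\land,\lor,\leftrightarrow,\top,\Diamond$ (with $\Diamond A := \neg\Box\neg A$) are the usual abbreviations. $\neg,\Box,\Diamond$ bind most strongly. $v(A)$ is the set of propositional variables contained in $A$. For a formula $A(p)$, $A(B)$ denotes the result of substituting $B$ for all occurrences of $p$ in $A(p)$. The logic $\mathbf{IL}^-$ has as axioms all instances of: $\mathbf{L1}$: all tautologies in this language; $\mathbf{L2}$: $\Box(A\to B)\to(\Box A\to\Box B)$; $\mathbf{L3}$: $\Box(\Box A\to A)\to\Box A$; $\mathbf{J3}$: $((A\rhd C)\land(B\rhd C))\to((A\lor B)\rhd C)$; $\mathbf{J6}$: $\Box A\leftrightarrow((\neg A)\rhd\bot)$. Its inference rules are Modus Ponens, Necessitation (from $A$ infer $\Box A$), $\mathbf{R1}$ (from $A\to B$ infer $(C\rhd A)\to(C\rhd B)$) and $\mathbf{R2}$ (from $A\to B$ infer $(B\rhd C)\to(A\rhd C)$). The logic $\mathbf{CL}$ has as axioms all instances of $\mathbf{L1}$, $\mathbf{L2}$, $\mathbf{L3}$, $\mathbf{J3}$ above together with $\mathbf{J1}$: $\Box(A\to B)\to(A\rhd B)$; $\mathbf{J2}$: $((A\rhd B)\land(B\rhd C))\to(A\rhd C)$;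 $\mathbf{J4}$: $(A\rhd B)\to(\Diamond A\to\Diamond B)$. Its inference rules are Modus Ponens and Necessitation. A logic is identified with its set of theorems, and is assumed closed under Modus Ponens, Necessitation and substitution of formulas for propositional variables; $L\subseteq L'$ means that every theorem of $L$ is a theorem of $L'$, and $L\vdash A$ means that $A$ is a theorem of $L$. A formula $A$ is left-modalized in $p$ if every occurrence of $p$ in $A$ is in the scope of some $\Box$ or $\rhd$, and $p\notin v(C)$ for any subformula $B\rhd C$ of $A$. $L$ has $\ell$FPP if for any formula $A(p)$ which is left-modalized in $p$, there exists a formula $F$ such that $v(F)\subseteq v(A)\setminus\{p\}$ and $L\vdash F\leftrightarrow A(F)$. $L$ has CIP if for any formulas $A$ and $B$ with $L\vdash A\to B$, there exists a formula $C$ such that $v(C)\subseteq v(A)\cap v(B)$, $L\vdash A\to C$ and $L\vdash C\to B$. *)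

theory Defs
  imports Main
begin

text \<open>The propositional variables are indexed by the natural numbers.\<close>

datatype form =
    Bot  ("\<^bold>\<bottom>")
  | Var nat
  | Imp form form  (infixr "\<^bold>\<longrightarrow>" 55)
  | Box form  ("\<^bold>\<box> _" [70] 70)
  | Rhd form form  (infix "\<rhd>" 58)

abbreviation Neg :: "form \<Rightarrow> form"  ("\<^bold>\<not> _" [70] 70)
  where "\<^bold>\<not> A \<equiv> A \<^bold>\<longrightarrow> \<^bold>\<bottom>"

abbreviation Or :: "form \<Rightarrow> form \<Rightarrow> form"  (infixr "\<^bold>\<or>" 60)
  where "A \<^bold>\<or> B \<equiv> \<^bold>\<not> A \<^bold>\<longrightarrow> B"

abbreviation And :: "form \<Rightarrow> form \<Rightarrow> form"  (infixr "\<^bold>\<and>" 65)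
  where "A \<^bold>\<and> B \<equiv> \<^bold>\<not> (A \<^bold>\<longrightarrow> \<^bold>\<not> B)"

abbreviation Iff :: "form \<Rightarrow> form \<Rightarrow> form"  (infix "\<^bold>\<longleftrightarrow>" 54)
  where "A \<^bold>\<longleftrightarrow> B \<equiv> (A \<^bold>\<longrightarrow> B) \<^bold>\<and> (B \<^bold>\<longrightarrow> A)"

abbreviation Dia :: "form \<Rightarrow> form"  ("\<^bold>\<diamond> _" [70] 70)
  where "\<^bold>\<diamond> A \<equiv> \<^bold>\<not> \<^bold>\<box> \<^bold>\<not> A"

primrec vars :: "form \<Rightarrow> nat set" where
  "vars \<^bold>\<bottom> = {}"
| "vars (Var q) = {q}"
| "vars (A \<^bold>\<longrightarrow> B) = vars A \<union> vars B"
| "vars (\<^bold>\<box> A) = vars A"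
| "vars (A \<rhd> B) = vars A \<union> vars B"

primrec subforms :: "form \<Rightarrow> form set" where
  "subforms \<^bold>\<bottom> = {\<^bold>\<bottom>}"
| "subforms (Var q) = {Var q}"
| "subforms (A \<^bold>\<longrightarrow> B) = insert (A \<^bold>\<longrightarrow> B) (subforms A \<union> subforms B)"
| "subforms (\<^bold>\<box> A) = insert (\<^bold>\<box> A) (subforms A)"
| "subforms (A \<rhd> B) = insert (A \<rhd> B) (subforms A \<union> subforms B)"

text \<open>Simultaneous substitution of formulas for propositional variables.\<close>

primrec subst :: "(nat \<Rightarrow> form) \<Rightarrow> form \<Rightarrow> form" where
  "subst s \<^bold>\<bottom> = \<^bold>\<bottom>"
| "subst s (Var q) = s q"
| "subst s (A \<^bold>\<longrightarrow> B) = subst s A \<^bold>\<longrightarrow> subst s B"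
| "subst s (\<^bold>\<box> A) = \<^bold>\<box> (subst s A)"
| "subst s (A \<rhd> B) = subst s A \<rhd> subst s B"

text \<open>If \<open>A\<close> is regarded as \<open>A(p)\<close>, then \<open>inst A p B\<close> is \<open>A(B)\<close>.\<close>

definition inst :: "form \<Rightarrow> nat \<Rightarrow> form \<Rightarrow> form" where
  "inst A p B = subst (Var(p := B)) A"

text \<open>
  A tautology in the modal language is true under every Boolean valuation that treats
  variables, boxed formulas and \<open>\<rhd>\<close>-formulas as independent atoms; \<open>e\<close> is only
  ever consulted on such formulas.
\<close>

primrec bool_eval :: "(form \<Rightarrow> bool) \<Rightarrow> form \<Rightarrow> bool" where
  "bool_eval e \<^bold>\<bottom> = False"
| "bool_eval e (Var q) = e (Var q)"
| "bool_eval e (A \<^bold>\<longrightarrow> B) = (bool_eval e A \<longrightarrow> bool_eval e B)"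
| "bool_eval e (\<^bold>\<box> A) = e (\<^bold>\<box> A)"
| "bool_eval e (A \<rhd> B) = e (A \<rhd> B)"

definition tautology :: "form \<Rightarrow> bool" where
  "tautology A \<longleftrightarrow> (\<forall>e. bool_eval e A)"

inductive_set IL_minus :: "form set" where
  L1: "tautology A \<Longrightarrow> A \<in> IL_minus"
| L2: "\<^bold>\<box> (A \<^bold>\<longrightarrow> B) \<^bold>\<longrightarrow> (\<^bold>\<box> A \<^bold>\<longrightarrow> \<^bold>\<box> B) \<in> IL_minus"
| L3: "\<^bold>\<box> (\<^bold>\<box> A \<^bold>\<longrightarrow> A) \<^bold>\<longrightarrow> \<^bold>\<box> A \<in> IL_minus"
| J3: "((A \<rhd> C) \<^bold>\<and> (B \<rhd> C)) \<^bold>\<longrightarrow> ((A \<^bold>\<or> B) \<rhd> C) \<in> IL_minus"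
| J6: "\<^bold>\<box> A \<^bold>\<longleftrightarrow> ((\<^bold>\<not> A) \<rhd> \<^bold>\<bottom>) \<in> IL_minus"
| MP: "A \<^bold>\<longrightarrow> B \<in> IL_minus \<Longrightarrow> A \<in> IL_minus \<Longrightarrow> B \<in> IL_minus"
| Nec: "A \<in> IL_minus \<Longrightarrow> \<^bold>\<box> A \<in> IL_minus"
| R1: "A \<^bold>\<longrightarrow> B \<in> IL_minus \<Longrightarrow> (C \<rhd> A) \<^bold>\<longrightarrow> (C \<rhd> B) \<in> IL_minus"
| R2: "A \<^bold>\<longrightarrow> B \<in> IL_minus \<Longrightarrow> (B \<rhd> C) \<^bold>\<longrightarrow> (A \<rhd> C) \<in> IL_minus"

inductive_set CL :: "form set" where
  L1: "tautology A \<Longrightarrow> A \<in> CL"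
| L2: "\<^bold>\<box> (A \<^bold>\<longrightarrow> B) \<^bold>\<longrightarrow> (\<^bold>\<box> A \<^bold>\<longrightarrow> \<^bold>\<box> B) \<in> CL"
| L3: "\<^bold>\<box> (\<^bold>\<box> A \<^bold>\<longrightarrow> A) \<^bold>\<longrightarrow> \<^bold>\<box> A \<in> CL"
| J1: "\<^bold>\<box> (A \<^bold>\<longrightarrow> B) \<^bold>\<longrightarrow> (A \<rhd> B) \<in> CL"
| J2: "((A \<rhd> B) \<^bold>\<and> (B \<rhd> C)) \<^bold>\<longrightarrow> (A \<rhd> C) \<in> CL"
| J3: "((A \<rhd> C) \<^bold>\<and> (B \<rhd> C)) \<^bold>\<longrightarrow> ((A \<^bold>\<or> B) \<rhd> C) \<in> CL"
| J4: "(A \<rhd> B) \<^bold>\<longrightarrow> (\<^bold>\<diamond> A \<^bold>\<longrightarrow> \<^bold>\<diamond> B) \<in> CL"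
| MP: "A \<^bold>\<longrightarrow> B \<in> CL \<Longrightarrow> A \<in> CL \<Longrightarrow> B \<in> CL"
| Nec: "A \<in> CL \<Longrightarrow> \<^bold>\<box> A \<in> CL"

text \<open>
  A logic is identified with its set of theorems, so \<open>A \<in> L\<close> expresses that \<open>A\<close> is a
  theorem of \<open>L\<close>. Closure under the rules R1 and R2 is not part of the notion.
\<close>

definition is_logic :: "form set \<Rightarrow> bool" where
  "is_logic L \<longleftrightarrow>
     (\<forall>A B. A \<^bold>\<longrightarrow> B \<in> L \<longrightarrow> A \<in> L \<longrightarrow> B \<in> L) \<and>
     (\<forall>A. A \<in> L \<longrightarrow> \<^bold>\<box> A \<in> L) \<and>
     (\<forall>A s. A \<in> L \<longrightarrow> subst s A \<in> L)"

text \<open>Every occurrence of \<open>p\<close> lies in the scope of some \<open>\<^bold>\<box>\<close> or \<open>\<rhd>\<close>.\<close>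

primrec modalized :: "nat \<Rightarrow> form \<Rightarrow> bool" where
  "modalized p \<^bold>\<bottom> = True"
| "modalized p (Var q) = (q \<noteq> p)"
| "modalized p (A \<^bold>\<longrightarrow> B) = (modalized p A \<and> modalized p B)"
| "modalized p (\<^bold>\<box> A) = True"
| "modalized p (A \<rhd> B) = True"

definition left_modalized :: "nat \<Rightarrow> form \<Rightarrow> bool" where
  "left_modalized p A \<longleftrightarrow>
     modalized p A \<and> (\<forall>B C. B \<rhd> C \<in> subforms A \<longrightarrow> p \<notin> vars C)"

definition has_lFPP :: "form set \<Rightarrow> bool" where
  "has_lFPP L \<longleftrightarrow>
     (\<forall>p A. left_modalized p A \<longrightarrow>
        (\<exists>F. vars F \<subseteq> vars A - {p} \<and> F \<^bold>\<longleftrightarrow> inst A p F \<in> L))"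

definition has_CIP :: "form set \<Rightarrow> bool" where
  "has_CIP L \<longleftrightarrow>
     (\<forall>A B. A \<^bold>\<longrightarrow> B \<in> L \<longrightarrow>
        (\<exists>C. vars C \<subseteq> vars A \<inter> vars B \<and> A \<^bold>\<longrightarrow> C \<in> L \<and> C \<^bold>\<longrightarrow> B \<in> L))"

end

theory Submission
  imports Defs
begin

text \<open>
  Both properties are refuted with \<open>A(p) = p \<rhd> r\<close> and one Veltman model of \<open>CL\<close>. Its worlds are
  the natural numbers, \<open>R\<close> is \<open>>\<close>, only \<open>0\<close> satisfies \<open>r\<close>, and apart from reflexivity \<open>S\<^sub>n\<close> leads
  from each \<open>m\<close> with \<open>m + 1 < n\<close> to \<open>0\<close>. For \<open>n \<ge> 2\<close> the only threat to \<open>p \<rhd> r\<close> at \<open>n\<close> is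
  therefore \<open>p\<close> at \<open>n - 1\<close>, so the fixed point alternates with the parity of \<open>n\<close>, whereas every
  formula containing only the variable \<open>r\<close> is eventually constant.

  Fixed points of \<open>p \<rhd> r\<close> are provably unique in \<open>IL\<^sup>-\<close>. An interpolant of the implication
  expressing uniqueness would contain only \<open>r\<close> and define the fixed point in this model.
\<close>

section \<open>The countermodel\<close>

text \<open>The \<open>\<rhd>\<close> clause has the Veltman relation at n already unfolded: m leads
  to itself and, if \<open>Suc m < n\<close>, also to 0.\<close>

primrec holds :: "(nat \<Rightarrow> nat \<Rightarrow> bool) \<Rightarrow> nat \<Rightarrow> form \<Rightarrow> bool" where
  "holds V n \<^bold>\<bottom> = False"
| "holds V n (Var q) = V q n"
| "holds V n (A \<^bold>\<longrightarrow> B) = (holds V n A \<longrightarrow> holds V n B)"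
| "holds V n (\<^bold>\<box> A) = (\<forall>m<n. holds V m A)"
| "holds V n (A \<rhd> B) =
     (\<forall>m<n. holds V m A \<longrightarrow> holds V m B \<or> (Suc m < n \<and> holds V 0 B))"

lemma holds_And: "holds V n (A \<^bold>\<and> B) \<longleftrightarrow> holds V n A \<and> holds V n B"
  by simp

lemma holds_Iff: "holds V n (A \<^bold>\<longleftrightarrow> B) \<longleftrightarrow> (holds V n A \<longleftrightarrow> holds V n B)"
  by auto

lemma bool_eval_holds: "bool_eval (holds V n) A = holds V n A"
  by (induction A) auto

lemma CL_sound: "A \<in> CL \<Longrightarrow> holds V n A"
proof (induction arbitrary: n rule: CL.induct)
  case (L1 A)
  then have "bool_eval (holds V n) A" by (simp add: tautology_def)
  then show ?case by (simp only: bool_eval_holds)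
next
  case (L3 A)
  have "holds V n (\<^bold>\<box> A)" if *: "holds V n (\<^bold>\<box> (\<^bold>\<box> A \<^bold>\<longrightarrow> A))"
  proof -
    have "m < n \<Longrightarrow> holds V m A" for m
    proof (induction m rule: less_induct)
      case (less m)
      have "holds V m (\<^bold>\<box> A)" using less by simp
      moreover have "holds V m (\<^bold>\<box> A \<^bold>\<longrightarrow> A)"
        using * less.prems by (simp only: holds.simps(4))
      ultimately show ?case by (simp only: holds.simps(3))
    qed
    then show ?thesis by simp
  qed
  then show ?case by (subst holds.simps(3)) blast
next
  case (J2 A B C)
  have "holds V m C \<or> (Suc m < n \<and> holds V 0 C)"
    if AB: "holds V n (A \<rhd> B)" and BC: "holds V n (B \<rhd> C)" and m: "m < n" "holds V m A" for m
  proof -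
    consider "holds V m B" | "Suc m < n" "holds V 0 B" using AB m by auto
    then show ?thesis
    proof cases
      case 1
      then show ?thesis using BC m(1) by auto
    next
      case 2
      \<comment> \<open>The world 0 is itself seen from n, so the second premise applies to it;
        either disjunct gives \<open>C\<close> at 0.\<close>
      moreover have "0 < n" using m(1) by simp
      ultimately show ?thesis using BC by auto
    qed
  qed
  then show ?case by simp
next
  case (J4 A B)
  have "\<exists>k<n. holds V k B" if "holds V n (A \<rhd> B)" "m < n" "holds V m A" for m
  proof -
    have "0 < n" using that(2) by simp
    then show ?thesis using that unfolding holds.simps(5) by blast
  qed
  then show ?case by auto
qed auto

text \<open>Boxed formulas can only turn from true to false as n grows. For
  \<open>A \<rhd> B\<close>, a world with \<open>A\<close> but with \<open>B\<close> neither there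
  nor at 0 spoils all larger n; if there is none, only the predecessor of n can violate the
  clause.\<close>

lemma holds_eventually_constant:
  assumes "\<And>q m. q \<in> vars A \<Longrightarrow> m > 0 \<Longrightarrow> \<not> V q m"
  shows "\<exists>N b. \<forall>n\<ge>N. holds V n A = b"
  using assms
proof (induction A)
  case Bot
  then show ?case by auto
next
  case (Var q)
  then have "\<forall>n\<ge>1. holds V n (Var q) = False" by simp
  then show ?case by blast
next
  case (Imp A B)
  then obtain N b M c where
    "\<forall>n\<ge>N. holds V n A = b" "\<forall>n\<ge>M. holds V n B = c"
    by auto
  then have "\<forall>n\<ge>max N M. holds V n (A \<^bold>\<longrightarrow> B) = (b \<longrightarrow> c)" by simp
  then show ?case by blast
next
  case (Box A)
  show ?case
  proof (cases "\<forall>m. holds V m A")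
    case True
    then show ?thesis by auto
  next
    case False
    then obtain m where "\<not> holds V m A" by blast
    then have "\<forall>n\<ge>Suc m. holds V n (\<^bold>\<box> A) = False" by (auto simp: Suc_le_eq)
    then show ?thesis by blast
  qed
next
  case (Rhd A B)
  then obtain N b M c where
    N: "\<forall>n\<ge>N. holds V n A = b" and M: "\<forall>n\<ge>M. holds V n B = c"
    by auto
  show ?case
  proof (cases "\<forall>m. holds V m A \<longrightarrow> holds V m B \<or> holds V 0 B")
    case False
    then obtain m where "holds V m A" "\<not> holds V m B" "\<not> holds V 0 B" by blast
    then have "\<forall>n\<ge>Suc m. holds V n (A \<rhd> B) = False" by (auto simp: Suc_le_eq)
    then show ?thesis by blast
  next
    case True
    have "holds V n (A \<rhd> B) = (b \<longrightarrow> c)" if "n \<ge> Suc (max N M)" for n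
    proof -
      obtain k where k: "n = Suc k" "k \<ge> N" "k \<ge> M"
        using \<open>n \<ge> Suc (max N M)\<close> by (cases n) auto
      \<comment> \<open>Every \<open>m < k\<close> may use 0 because \<open>Suc m < n\<close>, so
        only \<open>m = k\<close> is left.\<close>
      have "holds V n (A \<rhd> B) = (holds V k A \<longrightarrow> holds V k B)"
        using True k(1) by (auto simp: less_Suc_eq)
      then show ?thesis using N M k by simp
    qed
    then show ?thesis by blast
  qed
qed

text \<open>Only the predecessor of n can falsify the right-hand side, so \<open>X\<close> is
  determined by recursion. The predecessor 0 is harmless, hence both 0 and 1 are true before the
  alternation starts.\<close>

lemma fixed_point_parity:
  assumes "\<And>n. X n \<longleftrightarrow> (\<forall>m<n. X m \<longrightarrow> m = 0 \<or> Suc m < n)"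
  shows "X n \<longleftrightarrow> n = 0 \<or> odd n"
proof (induction n)
  case 0
  then show ?case using assms[of 0] by simp
next
  case (Suc n)
  have "X (Suc n) \<longleftrightarrow> (X n \<longrightarrow> n = 0)"
    using assms[of "Suc n"] by (auto simp: less_Suc_eq)
  then show ?case using Suc by auto
qed

lemma parity_not_definable:
  assumes "\<And>q m. q \<in> vars A \<Longrightarrow> m > 0 \<Longrightarrow> \<not> V q m"
  shows "\<exists>n. holds V n A \<noteq> (n = 0 \<or> odd n)"
proof (rule ccontr)
  assume "\<nexists>n. holds V n A \<noteq> (n = 0 \<or> odd n)"
  then have parity: "holds V n A \<longleftrightarrow> n = 0 \<or> odd n" for n by blast
  obtain N b where N: "\<forall>n\<ge>N. holds V n A = b"
    using holds_eventually_constant[of A V, OF assms] by auto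
  \<comment> \<open>Two neighbouring worlds beyond \<open>N\<close>, one odd and one even and
    positive, must agree although parity separates them.\<close>
  have "holds V (Suc (2 * N)) A = holds V (Suc (Suc (2 * N))) A"
    using N[rule_format, of "Suc (2 * N)"] N[rule_format, of "Suc (Suc (2 * N))"] by simp
  then show False using parity by simp
qed

section \<open>Uniqueness of fixed points\<close>

lemma IL_taut1: "A \<in> IL_minus \<Longrightarrow> tautology (A \<^bold>\<longrightarrow> B) \<Longrightarrow> B \<in> IL_minus"
  using IL_minus.L1 IL_minus.MP by blast

lemma IL_taut2:
  "A \<in> IL_minus \<Longrightarrow> B \<in> IL_minus \<Longrightarrow> tautology (A \<^bold>\<longrightarrow> B \<^bold>\<longrightarrow> C) \<Longrightarrow> C \<in> IL_minus"
  using IL_minus.L1 IL_minus.MP by blast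

lemma IL_taut3:
  "A \<in> IL_minus \<Longrightarrow> B \<in> IL_minus \<Longrightarrow> C \<in> IL_minus \<Longrightarrow>
    tautology (A \<^bold>\<longrightarrow> B \<^bold>\<longrightarrow> C \<^bold>\<longrightarrow> D) \<Longrightarrow> D \<in> IL_minus"
  using IL_minus.L1 IL_minus.MP by blast

lemma IL_box_mono: "A \<^bold>\<longrightarrow> B \<in> IL_minus \<Longrightarrow> \<^bold>\<box> A \<^bold>\<longrightarrow> \<^bold>\<box> B \<in> IL_minus"
  using IL_minus.L2 IL_minus.MP IL_minus.Nec by blast

lemma IL_box_taut: "tautology (A \<^bold>\<longrightarrow> B) \<Longrightarrow> \<^bold>\<box> A \<^bold>\<longrightarrow> \<^bold>\<box> B \<in> IL_minus"
  by (rule IL_box_mono[OF IL_minus.L1])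

lemma IL_box_conj: "\<^bold>\<box> A \<^bold>\<longrightarrow> \<^bold>\<box> B \<^bold>\<longrightarrow> \<^bold>\<box> (A \<^bold>\<and> B) \<in> IL_minus"
proof -
  have "\<^bold>\<box> A \<^bold>\<longrightarrow> \<^bold>\<box> (B \<^bold>\<longrightarrow> A \<^bold>\<and> B) \<in> IL_minus"
    by (rule IL_box_taut) (simp add: tautology_def)
  from IL_taut2[OF this IL_minus.L2[of B "A \<^bold>\<and> B"]]
  show ?thesis by (simp add: tautology_def)
qed

text \<open>Transitivity follows from Loeb's axiom for the conjunction of boxed \<open>A\<close> and
  \<open>A\<close>.\<close>

lemma IL_four: "\<^bold>\<box> A \<^bold>\<longrightarrow> \<^bold>\<box> \<^bold>\<box> A \<in> IL_minus"
proof -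
  let ?B = "\<^bold>\<box> A \<^bold>\<and> A"
  have "\<^bold>\<box> ?B \<^bold>\<longrightarrow> \<^bold>\<box> A \<in> IL_minus"
    by (rule IL_box_taut) (simp add: tautology_def)
  then have "A \<^bold>\<longrightarrow> (\<^bold>\<box> ?B \<^bold>\<longrightarrow> ?B) \<in> IL_minus"
    by (rule IL_taut1) (simp add: tautology_def)
  then have "\<^bold>\<box> A \<^bold>\<longrightarrow> \<^bold>\<box> (\<^bold>\<box> ?B \<^bold>\<longrightarrow> ?B) \<in> IL_minus"
    by (rule IL_box_mono)
  moreover have "\<^bold>\<box> ?B \<^bold>\<longrightarrow> \<^bold>\<box> \<^bold>\<box> A \<in> IL_minus"
    by (rule IL_box_taut) (simp add: tautology_def)
  ultimately show ?thesis
    by (rule IL_taut3[OF _ IL_minus.L3[of ?B]]) (simp add: tautology_def)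
qed

lemma IL_loeb: "\<^bold>\<box> A \<^bold>\<longrightarrow> A \<in> IL_minus \<Longrightarrow> A \<in> IL_minus"
  using IL_minus.L3 IL_minus.MP IL_minus.Nec by blast

text \<open>
  J6 turns \<open>\<^bold>\<box> (A \<^bold>\<longrightarrow> B)\<close> into \<open>\<^bold>\<not> (A \<^bold>\<longrightarrow> B) \<rhd> \<^bold>\<bottom>\<close>, which R1 weakens to
  \<open>\<^bold>\<not> (A \<^bold>\<longrightarrow> B) \<rhd> C\<close>; then J3 applies because \<open>A\<close> implies \<open>\<^bold>\<not> (A \<^bold>\<longrightarrow> B) \<^bold>\<or> B\<close>.
\<close>
lemma IL_rhd_box_antimono: "\<^bold>\<box> (A \<^bold>\<longrightarrow> B) \<^bold>\<longrightarrow> (B \<rhd> C) \<^bold>\<longrightarrow> (A \<rhd> C) \<in> IL_minus"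
proof -
  let ?D = "\<^bold>\<not> (A \<^bold>\<longrightarrow> B)"
  have "(?D \<rhd> \<^bold>\<bottom>) \<^bold>\<longrightarrow> (?D \<rhd> C) \<in> IL_minus"
    by (intro IL_minus.R1 IL_minus.L1) (simp add: tautology_def)
  with IL_minus.J6[of "A \<^bold>\<longrightarrow> B"] have 1: "\<^bold>\<box> (A \<^bold>\<longrightarrow> B) \<^bold>\<longrightarrow> (?D \<rhd> C) \<in> IL_minus"
    by (rule IL_taut2) (simp add: tautology_def)
  have 2: "((?D \<^bold>\<or> B) \<rhd> C) \<^bold>\<longrightarrow> (A \<rhd> C) \<in> IL_minus"
    by (intro IL_minus.R2 IL_minus.L1) (simp add: tautology_def)
  from 1 IL_minus.J3[of ?D C B] 2 show ?thesis
    by (rule IL_taut3) (simp add: tautology_def)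
qed

lemma IL_rhd_box_cong: "\<^bold>\<box> (A \<^bold>\<longleftrightarrow> B) \<^bold>\<longrightarrow> ((A \<rhd> C) \<^bold>\<longleftrightarrow> (B \<rhd> C)) \<in> IL_minus"
proof -
  have imp: "\<^bold>\<box> (A \<^bold>\<longleftrightarrow> B) \<^bold>\<longrightarrow> (B \<rhd> C) \<^bold>\<longrightarrow> (A \<rhd> C) \<in> IL_minus"
    by (rule IL_taut2[OF IL_box_taut[of "A \<^bold>\<longleftrightarrow> B" "A \<^bold>\<longrightarrow> B"] IL_rhd_box_antimono[of A B C]])
      (simp_all add: tautology_def)
  have conv: "\<^bold>\<box> (A \<^bold>\<longleftrightarrow> B) \<^bold>\<longrightarrow> (A \<rhd> C) \<^bold>\<longrightarrow> (B \<rhd> C) \<in> IL_minus"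
    by (rule IL_taut2[OF IL_box_taut[of "A \<^bold>\<longleftrightarrow> B" "B \<^bold>\<longrightarrow> A"] IL_rhd_box_antimono[of B A C]])
      (simp_all add: tautology_def)
  from imp conv show ?thesis
    by (rule IL_taut2) (simp only: tautology_def bool_eval.simps, blast)
qed

text \<open>By Loeb's rule one may assume that \<open>A\<close> and \<open>B\<close> agree under a
  box; then \<open>A \<rhd> C\<close> and \<open>B \<rhd> C\<close> agree, and the equations carry
  this over to \<open>A\<close> and \<open>B\<close>. If \<open>A\<close> and \<open>B\<close> are
  distinct variables, the two sides of the implication share only the variables of
  \<open>C\<close>.\<close>

lemma IL_fixed_point_unique:
  fixes A B C :: form
  defines "E \<equiv> A \<^bold>\<longleftrightarrow> (A \<rhd> C)" and "F \<equiv> B \<^bold>\<longleftrightarrow> (B \<rhd> C)"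
  shows "(\<^bold>\<box> E \<^bold>\<and> E \<^bold>\<and> A) \<^bold>\<longrightarrow> ((\<^bold>\<box> F \<^bold>\<and> F) \<^bold>\<longrightarrow> B) \<in> IL_minus"
proof -
  let ?G = "E \<^bold>\<and> F"
  let ?Y = "(\<^bold>\<box> ?G \<^bold>\<and> ?G) \<^bold>\<longrightarrow> (A \<^bold>\<longleftrightarrow> B)"
  \<comment> \<open>The antecedent of \<open>?Y\<close> implies its own boxed form, so boxed
    \<open>?Y\<close> yields the boxed equivalence of \<open>A\<close> and \<open>B\<close>.\<close>
  have "\<^bold>\<box> ?G \<^bold>\<longrightarrow> \<^bold>\<box> (\<^bold>\<box> ?G \<^bold>\<and> ?G) \<in> IL_minus"
    by (rule IL_taut2[OF IL_four[of ?G] IL_box_conj[of "\<^bold>\<box> ?G" ?G]])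
      (simp add: tautology_def)
  from this IL_minus.L2[of "\<^bold>\<box> ?G \<^bold>\<and> ?G" "A \<^bold>\<longleftrightarrow> B"] IL_rhd_box_cong[of A B C]
  have "\<^bold>\<box> ?Y \<^bold>\<longrightarrow> ?Y \<in> IL_minus"
    by (rule IL_taut3) (simp only: tautology_def bool_eval.simps E_def F_def, blast)
  then have "?Y \<in> IL_minus" by (rule IL_loeb)
  from this IL_box_conj[of E F] show ?thesis
    by (rule IL_taut2) (simp only: tautology_def bool_eval.simps, blast)
qed

theorem corollary6p2:
  fixes L :: "form set"
  assumes "is_logic L"
    and "IL_minus \<subseteq> L"
    and "L \<subseteq> CL"
  shows "\<not> has_lFPP L \<and> \<not> has_CIP L"
proof
  \<comment> \<open>Variable 1 plays r; all others take the values of the fixed point, so one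
    valuation serves both refutations.\<close>
  define V :: "nat \<Rightarrow> nat \<Rightarrow> bool"
    where "V = (\<lambda>q n. if q = 1 then n = 0 else n = 0 \<or> odd n)"
  have V_1: "V 1 n \<longleftrightarrow> n = 0" for n by (simp add: V_def)
  have V_parity: "V q n \<longleftrightarrow> n = 0 \<or> odd n" if "q \<noteq> 1" for q n
    using that by (simp add: V_def)
  have sound: "holds V n A" if "A \<in> L" for n A
    using that assms(3) CL_sound by blast
  have undefinable: "\<exists>n. holds V n A \<noteq> (n = 0 \<or> odd n)" if "vars A \<subseteq> {1}" for A
    using that by (intro parity_not_definable) (use V_1 in auto)
  show "\<not> has_lFPP L"
  proof
    assume "has_lFPP L"
    moreover have "left_modalized 0 (Var 0 \<rhd> Var 1)"
      by (simp add: left_modalized_def)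
    ultimately obtain F where F: "vars F \<subseteq> vars (Var 0 \<rhd> Var 1) - {0}"
      "F \<^bold>\<longleftrightarrow> inst (Var 0 \<rhd> Var 1) 0 F \<in> L"
      unfolding has_lFPP_def by blast
    have "holds V n F \<longleftrightarrow> holds V n (F \<rhd> Var 1)" for n
      using sound[OF F(2), of n] unfolding inst_def by auto
    \<comment> \<open>As \<open>Var 1\<close> holds only at 0, the truth condition of
      \<open>F \<rhd> Var 1\<close> becomes the recursion solved by
      \<open>fixed_point_parity\<close>.\<close>
    then have "holds V n F \<longleftrightarrow> (\<forall>m<n. holds V m F \<longrightarrow> m = 0 \<or> Suc m < n)" for n
      unfolding holds.simps V_1 by blast
    from fixed_point_parity[OF this] undefinable[of F] F(1) show False by auto
  qed
  show "\<not> has_CIP L"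
  proof
    \<comment> \<open>Variables 0 and 2 are two names for the fixed point, so an interpolant may
      contain only variable 1.\<close>
    let ?E = "\<lambda>q. Var q \<^bold>\<longleftrightarrow> (Var q \<rhd> Var 1)"
    let ?A = "\<^bold>\<box> (?E 0) \<^bold>\<and> ?E 0 \<^bold>\<and> Var 0"
    let ?B = "(\<^bold>\<box> (?E 2) \<^bold>\<and> ?E 2) \<^bold>\<longrightarrow> Var 2"
    assume "has_CIP L"
    moreover have "?A \<^bold>\<longrightarrow> ?B \<in> L"
      using IL_fixed_point_unique[of "Var 0" "Var 1" "Var 2"] assms(2) by blast
    ultimately obtain C where C: "vars C \<subseteq> vars ?A \<inter> vars ?B"
      "?A \<^bold>\<longrightarrow> C \<in> L" "C \<^bold>\<longrightarrow> ?B \<in> L"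
      unfolding has_CIP_def by blast
    have E: "holds V n (?E q)" if "q \<noteq> 1" for n q
    proof -
      have "(n = 0 \<or> odd n) \<longleftrightarrow> (\<forall>m<n. m = 0 \<or> odd m \<longrightarrow> m = 0 \<or> Suc m < n)"
      proof (cases n)
        case (Suc k)
        then show ?thesis by (auto simp: less_Suc_eq)
      qed simp
      then show ?thesis
        unfolding holds_Iff holds.simps(2,5) V_1 V_parity[OF that] by simp
    qed
    have box_E: "holds V n (\<^bold>\<box> (?E q))" if "q \<noteq> 1" for n q
      unfolding holds.simps(4) using E[OF that] by blast
    \<comment> \<open>Both equations hold at every world, so \<open>C\<close> lies between
      \<open>Var 0\<close> and \<open>Var 2\<close>, which have the same truth values.\<close>
    have "holds V n C \<longleftrightarrow> n = 0 \<or> odd n" for n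
    proof -
      have "holds V n (Var 0) \<longrightarrow> holds V n C"
        using sound[OF C(2), of n] E[of 0 n] box_E[of 0 n]
        unfolding holds_And holds.simps(3)[of V n ?A] by simp
      moreover have "holds V n C \<longrightarrow> holds V n (Var 2)"
        using sound[OF C(3), of n] E[of 2 n] box_E[of 2 n]
        unfolding holds.simps(3)[of V n C] holds.simps(3)[of V n "\<^bold>\<box> (?E 2) \<^bold>\<and> ?E 2"] holds_And
        by simp
      ultimately show ?thesis
        using V_parity[of 0 n] V_parity[of 2 n] unfolding holds.simps(2) by auto
    qed
    then show False using undefinable[of C] C(1) by auto
  qed
qed

end
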